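(* Consider the problem $$\min_{\bm{X}}\ \langle \bm{X},\bm{H}_{ijl}\rangle\quad\text{s.t.}\quad \|\bm{X}-\bm{Q}\|_F^2\le r^2,\quad \langle \bm{P},\bm{X}\rangle\ge 0,$$ where $\bm{P}\in\mathbb{R}^{d\times d}$ is such that the half-space $\{\bm{X}\in\mathbb{R}^{d\times d}\mid\langle\bm{P},\bm{X}\rangle\ge 0\}$ contains the cone of positive semi-definite $d\times d$ matrices. Its optimal solution $\bm{X}^\star$ satisfies $$\langle\bm{H}_{ijl},\bm{X}^\star\rangle=\begin{cases}0, & \text{if } \bm{H}_{ijl}=a\bm{P},\\[2pt] \langle\bm{H}_{ijl},\bm{Q}\rangle-r\|\bm{H}_{ijl}\|_F, & \text{if } \left\langle\bm{P},\ \bm{Q}-r\frac{\bm{H}_{ijl}}{\|\bm{H}_{ijl}\|_F}\right\rangle\ge 0,\\[4pt] \left\langle\bm{H}_{ijl},\ \frac{\beta\bm{P}-\bm{H}_{ijl}}{\alpha}+\bm{Q}\right\rangle, & \text{otherwise},\end{cases}$$ where $a$ is a constant, and $$\alpha=\sqrt{\frac{\|\bm{P}\|_F^2\|\bm{H}_{ijl}\|_F^2-\langle\bm{P},\bm{H}_{ijl}\rangle^2}{r^2\|\bm{P}\|_F^2-\langle\bm{P},\bm{Q}\rangle^2}},\qquad \beta=\frac{\langle\bm{P},\bm{H}_{ijl}\rangle-\alpha\langle\bm{P},\bm{Q}\rangle}{\|\bm{P}\|_F^2}.$$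
   Context: $\langle\bm{A},\bm{B}\rangle=\mathrm{tr}(\bm{A}^\top\bm{B})$ is the matrix inner product and $\|\bm{A}\|_F^2=\langle\bm{A},\bm{A}\rangle$. Given vectors $\bm{x}_1,\dots,\bm{x}_n\in\mathbb{R}^d$ with labels $y_1,\dots,y_n$, a triplet is $(i,j,l)\in\{1,\dots,n\}^3$ with $y_i=y_j$, $i\neq j$, $y_i\neq y_l$; $\mathcal{T}$ is the set of triplets, and $\bm{H}_{ijl}=(\bm{x}_i-\bm{x}_l)(\bm{x}_i-\bm{x}_l)^\top-(\bm{x}_i-\bm{x}_j)(\bm{x}_i-\bm{x}_j)^\top$ for $(i,j,l)\in\mathcal{T}$. The matrix $\bm{Q}\in\mathbb{R}^{d\times d}$ and the number $r\ge 0$ are the center and radius of a hypersphere (in Frobenius norm) known to contain $\bm{M}^\star$, the minimizer over positive semi-definite $\bm{M}\in\mathbb{R}^{d\times d}$ of $\sum_{(i,j,l)\in\mathcal{T}}\ell(\langle\bm{M},\bm{H}_{ijl}\rangle)+\frac{\lambda}{2}\|\bm{M}\|_F^2$, where $\lambda>0$ and $\ell$ is either the hinge loss $\ell(x)=\max\{0,1-x\}$ or, for a parameter $\gamma>0$, the smoothed hinge loss ($\ell(x)=0$ for $x>1$, $\frac{1}{2\gamma}(1-x)^2$ for $1-\gamma\le x\le 1$, $1-x-\frac{\gamma}{2}$ for $x<1-\gamma$).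
   Formalization: Where the first two cases overlap, the second takes precedence (the printed value 0 can be false there; the second case's condition includes H ≠ 0), and the third case assumes r²‖P‖² ≠ ⟨P,Q⟩², since otherwise α is undefined. *)

theory Defs
  imports "HOL-Analysis.Analysis"
begin

definition frob_inner :: "real^'n^'m \<Rightarrow> real^'n^'m \<Rightarrow> real" where
  "frob_inner A B = trace (transpose A ** B)"

definition frob_norm :: "real^'n^'m \<Rightarrow> real" where
  "frob_norm A = sqrt (frob_inner A A)"

lemma frob_inner_eq_inner: "frob_inner A B = A \<bullet> B"
proof -
  have "frob_inner A B = (\<Sum>j\<in>UNIV. \<Sum>i\<in>UNIV. A $ i $ j * B $ i $ j)"
    by (simp add: frob_inner_def trace_def transpose_def matrix_matrix_mult_def)
  also have "\<dots> = (\<Sum>i\<in>UNIV. \<Sum>j\<in>UNIV. A $ i $ j * B $ i $ j)"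
    by (rule sum.swap)
  finally show ?thesis
    by (simp add: inner_vec_def)
qed

lemma frob_norm_eq_norm: "frob_norm A = norm A"
  by (simp add: frob_norm_def frob_inner_eq_inner norm_eq_sqrt_inner)

text \<open>Positive semi-definiteness includes symmetry.\<close>

definition psd :: "real^'d^'d \<Rightarrow> bool" where
  "psd M \<longleftrightarrow> transpose M = M \<and> (\<forall>v. 0 \<le> v \<bullet> (M *v v))"

definition outer :: "real^'m \<Rightarrow> real^'n \<Rightarrow> real^'n^'m" where
  "outer u v = (\<chi> i j. u $ i * v $ j)"

definition triplets :: "nat \<Rightarrow> (nat \<Rightarrow> 'c) \<Rightarrow> (nat \<times> nat \<times> nat) set" where
  "triplets n y = {(i, j, l). i \<in> {1..n} \<and> j \<in> {1..n} \<and> l \<in> {1..n} \<and>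
     y i = y j \<and> i \<noteq> j \<and> y i \<noteq> y l}"

definition triplet_mat :: "(nat \<Rightarrow> real^'d) \<Rightarrow> nat \<Rightarrow> nat \<Rightarrow> nat \<Rightarrow> real^'d^'d" where
  "triplet_mat x i j l = outer (x i - x l) (x i - x l) - outer (x i - x j) (x i - x j)"

definition hinge :: "real \<Rightarrow> real" where
  "hinge t = max 0 (1 - t)"

definition smoothed_hinge :: "real \<Rightarrow> real \<Rightarrow> real" where
  "smoothed_hinge \<gamma> t =
     (if t > 1 then 0
      else if 1 - \<gamma> \<le> t then (1 - t)\<^sup>2 / (2 * \<gamma>)
      else 1 - t - \<gamma> / 2)"

definition metric_objective ::
  "(real \<Rightarrow> real) \<Rightarrow> real \<Rightarrow> nat \<Rightarrow> (nat \<Rightarrow> real^'d) \<Rightarrow> (nat \<Rightarrow> 'c) \<Rightarrow> real^'d^'d \<Rightarrow> real" where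
  "metric_objective loss lam n x y M =
     (\<Sum>(i, j, l)\<in>triplets n y. loss (frob_inner M (triplet_mat x i j l)))
       + lam / 2 * (frob_norm M)\<^sup>2"

definition screening_feasible ::
  "real^'d^'d \<Rightarrow> real \<Rightarrow> real^'d^'d \<Rightarrow> real^'d^'d \<Rightarrow> bool" where
  "screening_feasible Q r P X \<longleftrightarrow> (frob_norm (X - Q))\<^sup>2 \<le> r\<^sup>2 \<and> 0 \<le> frob_inner P X"

definition screening_solution ::
  "real^'d^'d \<Rightarrow> real^'d^'d \<Rightarrow> real \<Rightarrow> real^'d^'d \<Rightarrow> real^'d^'d \<Rightarrow> bool" where
  "screening_solution H Q r P X \<longleftrightarrow>
     is_arg_min (\<lambda>Y. frob_inner Y H) (screening_feasible Q r P) X"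

text \<open>The condition under which the minimizer over the ball alone satisfies the half-space
  constraint. It mentions \<open>H / \<parallel>H\<parallel>\<close>, so it is meaningful only for nonzero \<open>H\<close>.\<close>

definition ball_minimizer_feasible ::
  "real^'d^'d \<Rightarrow> real^'d^'d \<Rightarrow> real \<Rightarrow> real^'d^'d \<Rightarrow> bool" where
  "ball_minimizer_feasible H Q r P \<longleftrightarrow>
     H \<noteq> 0 \<and> 0 \<le> frob_inner P (Q - r *\<^sub>R (H /\<^sub>R frob_norm H))"

end

theory Submission
  imports Defs
begin

text \<open>Everything takes place in the Euclidean space of matrices with the Frobenius inner product.
  Over the ball alone the minimum is given by Cauchy--Schwarz. If that minimizer violates
  \<open>\<langle>P, X\<rangle> \<ge> 0\<close>, then \<open>X\<^sub>0 = (\<beta> P - H) / \<alpha> + Q\<close> satisfies the KKT conditions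
  \<open>H = \<beta> P - \<alpha> (X\<^sub>0 - Q)\<close>, \<open>\<parallel>X\<^sub>0 - Q\<parallel> = r\<close>, \<open>\<langle>P, X\<^sub>0\<rangle> = 0\<close>, which are sufficient because
  \<open>\<alpha>, \<beta> \<ge> 0\<close>. That \<open>\<beta> \<ge> 0\<close> holds is exactly the infeasibility of the minimizer over the ball.
  The matrix \<open>M\<^sup>\<star>\<close> only serves as a feasible point.\<close>

lemma inner_ball_ge:
  fixes H Q Y :: "'a::real_inner"
  assumes "norm (Y - Q) \<le> r"
  shows "H \<bullet> Q - r * norm H \<le> H \<bullet> Y"
proof -
  have "\<bar>H \<bullet> (Y - Q)\<bar> \<le> norm H * norm (Y - Q)"
    by (rule Cauchy_Schwarz_ineq2)
  also have "\<dots> \<le> norm H * r"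
    using assms by (intro mult_left_mono) auto
  finally show ?thesis
    by (simp add: inner_diff_right mult.commute)
qed

text \<open>For \<open>H = 0\<close> the direction \<open>H /\<^sub>R norm H\<close> is
  \<open>0\<close> by the convention for division by zero, so the center itself plays the role of
  the minimizer.\<close>

lemma inner_ball_minimizer:
  fixes H Q :: "'a::real_inner"
  shows "H \<bullet> (Q - r *\<^sub>R (H /\<^sub>R norm H)) = H \<bullet> Q - r * norm H"
  by (cases "H = 0") (simp_all add: inner_diff_right dot_square_norm power2_eq_square)

lemma norm_ball_minimizer:
  fixes H Q :: "'a::real_inner"
  assumes "0 \<le> r"
  shows "norm ((Q - r *\<^sub>R (H /\<^sub>R norm H)) - Q) \<le> r"
  using assms by (cases "H = 0") (simp_all add: mult.assoc)

text \<open>Sufficiency of the KKT conditions. A boundary point \<open>X\<close> of the ball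
  maximizes the inner product with \<open>X - Q\<close> over the ball, so the ball term contributes
  nonnegatively to \<open>H \<bullet> (Y - X)\<close>; the half-space term does too because
  \<open>P \<bullet> X = 0\<close>.\<close>

lemma ball_halfspace_kkt:
  fixes H P Q X Y :: "'a::real_inner"
  assumes "H = \<beta> *\<^sub>R P - \<alpha> *\<^sub>R (X - Q)" "0 \<le> \<alpha>" "0 \<le> \<beta>"
    and "norm (X - Q) = r" "P \<bullet> X = 0"
    and Y: "norm (Y - Q) \<le> r" "0 \<le> P \<bullet> Y"
  shows "H \<bullet> X \<le> H \<bullet> Y"
proof -
  have "(X - Q) \<bullet> (Y - Q) \<le> norm (X - Q) * norm (Y - Q)"
    by (rule norm_cauchy_schwarz)
  also have "\<dots> \<le> norm (X - Q) * norm (X - Q)"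
    using assms by (intro mult_left_mono) auto
  also have "\<dots> = (X - Q) \<bullet> (X - Q)"
    by (simp add: dot_square_norm power2_eq_square)
  finally have le: "(X - Q) \<bullet> (Y - X) \<le> 0"
    by (simp add: inner_diff_right)
  have "H \<bullet> Y - H \<bullet> X = \<beta> * (P \<bullet> Y - P \<bullet> X) - \<alpha> * ((X - Q) \<bullet> (Y - X))"
    by (simp add: assms(1) inner_diff_left inner_diff_right algebra_simps)
  moreover have "0 \<le> \<beta> * (P \<bullet> Y - P \<bullet> X)" "\<alpha> * ((X - Q) \<bullet> (Y - X)) \<le> 0"
    using assms le by (simp_all add: mult_nonneg_nonpos)
  ultimately show ?thesis by linarith
qed

text \<open>Scalar form of \<beta> > 0, with p, h, a, b standing for \<open>P \<bullet> Q\<close>,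
  \<open>P \<bullet> H\<close>, \<open>norm P\<close>, \<open>norm H\<close>. The formula for
  \<alpha> links the squares of the two sides of \<open>\<alpha> * p < h\<close> to those of
  \<open>p * b < r * h\<close>.\<close>

lemma ball_halfspace_multiplier_pos:
  fixes p h r \<alpha> a b :: real
  assumes "0 \<le> r" "0 \<le> b" "0 < \<alpha>"
    and infeas: "p * b < r * h"
    and D: "0 < r\<^sup>2 * a\<^sup>2 - p\<^sup>2"
    and \<alpha>: "\<alpha>\<^sup>2 * (r\<^sup>2 * a\<^sup>2 - p\<^sup>2) = a\<^sup>2 * b\<^sup>2 - h\<^sup>2"
    and a: "0 < a"
  shows "\<alpha> * p < h"
proof -
  define D where "D = r\<^sup>2 * a\<^sup>2 - p\<^sup>2"
  \<comment> \<open>Since \<open>D\<close> and \<open>a\<close> are positive, the two differences of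
    squares have the same sign.\<close>
  have key: "(h\<^sup>2 - (\<alpha> * p)\<^sup>2) * D = a\<^sup>2 * ((r * h)\<^sup>2 - (p * b)\<^sup>2)"
  proof -
    have "(h\<^sup>2 - (\<alpha> * p)\<^sup>2) * D = h\<^sup>2 * D - p\<^sup>2 * (\<alpha>\<^sup>2 * D)"
      by (simp add: power_mult_distrib algebra_simps)
    also have "\<dots> = h\<^sup>2 * D - p\<^sup>2 * (a\<^sup>2 * b\<^sup>2 - h\<^sup>2)"
      using \<alpha> by (simp add: D_def)
    finally show ?thesis
      by (simp add: D_def power_mult_distrib algebra_simps)
  qed
  \<comment> \<open>Comparing squares reproduces the order for nonnegative sides and reverses it for
    nonpositive ones; for opposite signs the claim is immediate.\<close>
  consider "0 \<le> p" | "p < 0" "0 \<le> h" | "p < 0" "h < 0" by linarith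
  then show ?thesis
  proof cases
    case 1
    then have "0 \<le> p * b" using assms by simp
    then have "0 < r * h" using infeas by linarith
    then have "0 < h" using \<open>0 \<le> r\<close> by (simp add: zero_less_mult_iff)
    have "(p * b)\<^sup>2 < (r * h)\<^sup>2"
      using infeas \<open>0 \<le> p * b\<close> by (intro power_strict_mono) auto
    then have "0 < (h\<^sup>2 - (\<alpha> * p)\<^sup>2) * D"
      unfolding key using a by simp
    then have "(\<alpha> * p)\<^sup>2 < h\<^sup>2"
      using D by (simp add: D_def zero_less_mult_iff)
    then show ?thesis
      using \<open>0 < h\<close> by (rule power2_less_imp_less[OF _ less_imp_le])
  next
    case 2
    then have "\<alpha> * p < 0" using \<open>0 < \<alpha>\<close> by (simp add: mult_pos_neg)
    then show ?thesis using 2 by linarith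
  next
    case 3
    then have "r * h \<le> 0" using \<open>0 \<le> r\<close> by (simp add: mult_nonneg_nonpos)
    then have "(- (r * h))\<^sup>2 < (- (p * b))\<^sup>2"
      using infeas by (intro power_strict_mono) auto
    then have "(h\<^sup>2 - (\<alpha> * p)\<^sup>2) * D < 0"
      unfolding key using a by (intro mult_pos_neg) auto
    then have "h\<^sup>2 < (\<alpha> * p)\<^sup>2"
      using D by (simp add: D_def mult_less_0_iff)
    then have "(- h)\<^sup>2 < (- (\<alpha> * p))\<^sup>2" by simp
    then have "- h < - (\<alpha> * p)"
      using 3 \<open>0 < \<alpha>\<close> by (elim power2_less_imp_less) (simp add: mult_nonneg_nonpos)
    then show ?thesis by simp
  qed
qed

text \<open>Equality would make \<open>0\<close>, \<open>P\<close>, \<open>H\<close> collinear,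
  hence \<open>H\<close> a multiple of \<open>P\<close>. The strict form makes the numerator under
  the root of \<alpha> positive.\<close>

lemma cauchy_schwarz_strict:
  fixes P H :: "'a::real_inner"
  assumes "P \<noteq> 0" "\<nexists>a. H = a *\<^sub>R P"
  shows "(P \<bullet> H)\<^sup>2 < (norm P)\<^sup>2 * (norm H)\<^sup>2"
proof -
  have "\<bar>P \<bullet> H\<bar> \<noteq> norm P * norm H"
  proof
    assume "\<bar>P \<bullet> H\<bar> = norm P * norm H"
    then have "collinear {0, P, H}" by (simp add: norm_cauchy_schwarz_equal)
    then show False using assms by (auto simp: collinear_lemma)
  qed
  with Cauchy_Schwarz_ineq2[of P H] have "\<bar>P \<bullet> H\<bar> < norm P * norm H" by simp
  then have "\<bar>P \<bullet> H\<bar>\<^sup>2 < (norm P * norm H)\<^sup>2"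
    by (intro power_strict_mono) auto
  then show ?thesis by (simp add: power_mult_distrib)
qed

text \<open>Hypothesis \<open>D\<close> rules out a hyperplane tangent to the ball, where the
  quotient defining \<alpha> would have denominator zero.\<close>

lemma ball_halfspace_min_boundary:
  fixes H P Q M Y :: "'a::real_inner" and r :: real
  assumes r: "0 \<le> r"
    and M: "norm (M - Q) \<le> r" "0 \<le> P \<bullet> M"
    and indep: "\<nexists>a. H = a *\<^sub>R P"
    and infeas: "P \<bullet> (Q - r *\<^sub>R (H /\<^sub>R norm H)) < 0"
    and D: "r\<^sup>2 * (norm P)\<^sup>2 - (P \<bullet> Q)\<^sup>2 \<noteq> 0"
    and \<alpha>: "\<alpha> = sqrt (((norm P)\<^sup>2 * (norm H)\<^sup>2 - (P \<bullet> H)\<^sup>2)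
                  / (r\<^sup>2 * (norm P)\<^sup>2 - (P \<bullet> Q)\<^sup>2))"
    and \<beta>: "\<beta> = (P \<bullet> H - \<alpha> * (P \<bullet> Q)) / (norm P)\<^sup>2"
    and X: "X = (\<beta> *\<^sub>R P - H) /\<^sub>R \<alpha> + Q"
  shows "norm (X - Q) \<le> r" "0 \<le> P \<bullet> X"
    and "norm (Y - Q) \<le> r \<Longrightarrow> 0 \<le> P \<bullet> Y \<Longrightarrow> H \<bullet> X \<le> H \<bullet> Y"
proof -
  define p where "p = P \<bullet> Q"
  define h where "h = P \<bullet> H"
  have "P \<noteq> 0" using infeas by auto
  have "H \<noteq> 0" using indep by (metis scale_zero_left)
  have nP: "0 < norm P" and nH: "0 < norm H" using \<open>P \<noteq> 0\<close> \<open>H \<noteq> 0\<close> by auto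
  have N: "0 < (norm P)\<^sup>2 * (norm H)\<^sup>2 - h\<^sup>2"
    using cauchy_schwarz_strict[OF \<open>P \<noteq> 0\<close> indep] by (simp add: h_def)
  have infeas': "p * norm H < r * h"
    using infeas nH by (simp add: p_def h_def inner_diff_right field_simps)
  \<comment> \<open>The two bounds on \<open>p\<close> say that the hyperplane meets the ball: one
    comes from the feasible point \<open>M\<close>, the other from the infeasibility of the ball
    minimizer. With \<open>D\<close> the denominator of \<alpha> is then positive.\<close>
  have "- (r * norm P) \<le> p"
    using inner_ball_ge[of M Q r "- P"] M by (simp add: p_def)
  moreover have "p \<le> r * norm P"
  proof -
    have "r * h \<le> r * (norm P * norm H)"
      using r by (intro mult_left_mono) (auto simp: h_def norm_cauchy_schwarz)
    then have "p * norm H \<le> (r * norm P) * norm H"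
      using infeas' by (simp add: mult.assoc)
    then show ?thesis using nH by simp
  qed
  ultimately have "p\<^sup>2 \<le> (r * norm P)\<^sup>2"
    by (intro abs_le_square_iff[THEN iffD1]) auto
  with D have D': "0 < r\<^sup>2 * (norm P)\<^sup>2 - p\<^sup>2"
    by (simp add: p_def power_mult_distrib)
  have \<alpha>_pos: "0 < \<alpha>"
    using N D' by (simp add: \<alpha> p_def h_def)
  have "\<alpha>\<^sup>2 = ((norm P)\<^sup>2 * (norm H)\<^sup>2 - h\<^sup>2) / (r\<^sup>2 * (norm P)\<^sup>2 - p\<^sup>2)"
    using N D' by (simp add: \<alpha> p_def h_def)
  then have \<alpha>_sq: "\<alpha>\<^sup>2 * (r\<^sup>2 * (norm P)\<^sup>2 - p\<^sup>2) = (norm P)\<^sup>2 * (norm H)\<^sup>2 - h\<^sup>2"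
    using D' by simp
  have "\<alpha> * p < h"
    using ball_halfspace_multiplier_pos[OF r _ \<alpha>_pos infeas' D' \<alpha>_sq nP] by simp
  then have \<beta>_nonneg: "0 \<le> \<beta>" by (simp add: \<beta> p_def h_def)
  have \<beta>P: "\<beta> * (norm P)\<^sup>2 = h - \<alpha> * p"
    using nP by (simp add: \<beta> p_def h_def)
  have XQ: "\<alpha> *\<^sub>R (X - Q) = \<beta> *\<^sub>R P - H"
    using \<alpha>_pos by (simp add: X)
  then have HX: "H = \<beta> *\<^sub>R P - \<alpha> *\<^sub>R (X - Q)" by simp
  have "\<alpha> * (P \<bullet> X - p) = P \<bullet> (\<alpha> *\<^sub>R (X - Q))"
    by (simp add: p_def inner_diff_right)
  also have "\<dots> = \<beta> * (norm P)\<^sup>2 - h"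
    unfolding XQ by (simp add: h_def inner_diff_right dot_square_norm)
  also have "\<dots> = - (\<alpha> * p)" by (simp add: \<beta>P)
  finally have PX: "P \<bullet> X = 0" using \<alpha>_pos by (simp add: right_diff_distrib)
  \<comment> \<open>The factor \<open>(norm P)\<^sup>2\<close> lets \<beta> occur only in the
    product \<open>\<beta> * (norm P)\<^sup>2\<close>, which is \<open>h - \<alpha> * p\<close>; the
    mixed terms cancel and \<open>\<alpha>_sq\<close> leaves the radius.\<close>
  have "(norm P)\<^sup>2 * (\<alpha>\<^sup>2 * (norm (X - Q))\<^sup>2) = (norm P)\<^sup>2 * (norm (\<alpha> *\<^sub>R (X - Q)))\<^sup>2"
    by (simp add: power_mult_distrib)
  also have "\<dots> = (norm P)\<^sup>2 * (\<beta>\<^sup>2 * (norm P)\<^sup>2 - 2 * \<beta> * h + (norm H)\<^sup>2)"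
    unfolding XQ power2_norm_eq_inner
    by (simp add: inner_diff_left inner_diff_right h_def inner_commute[of H P]
        power2_eq_square[of \<beta>] algebra_simps)
  also have "\<dots> = (\<beta> * (norm P)\<^sup>2)\<^sup>2 - 2 * (\<beta> * (norm P)\<^sup>2) * h + (norm P)\<^sup>2 * (norm H)\<^sup>2"
    by (simp add: power2_eq_square algebra_simps)
  also have "\<dots> = \<alpha>\<^sup>2 * p\<^sup>2 + ((norm P)\<^sup>2 * (norm H)\<^sup>2 - h\<^sup>2)"
    unfolding \<beta>P by (simp add: power2_eq_square algebra_simps)
  also have "\<dots> = (norm P)\<^sup>2 * (\<alpha>\<^sup>2 * r\<^sup>2)"
    unfolding \<alpha>_sq[symmetric] by (simp add: algebra_simps)
  finally have "(norm (X - Q))\<^sup>2 = r\<^sup>2" using nP \<alpha>_pos by simp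
  then have nXQ: "norm (X - Q) = r" using r by simp
  show "norm (X - Q) \<le> r" "0 \<le> P \<bullet> X" using nXQ PX by auto
  show "H \<bullet> X \<le> H \<bullet> Y" if "norm (Y - Q) \<le> r" "0 \<le> P \<bullet> Y"
    using ball_halfspace_kkt[OF HX _ \<beta>_nonneg nXQ PX that] \<alpha>_pos by simp
qed

text \<open>Intermediate value argument on the connected ball, between \<open>Z\<close> and
  \<open>M\<close>.\<close>

lemma ball_meets_hyperplane:
  fixes P Q M Z :: "'a::real_inner"
  assumes "norm (M - Q) \<le> r" "0 \<le> P \<bullet> M" "norm (Z - Q) \<le> r" "P \<bullet> Z \<le> 0"
  obtains W where "norm (W - Q) \<le> r" "P \<bullet> W = 0"
proof -
  have "connected (cball Q r)" by (intro convex_connected convex_cball)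
  then have "connected ((\<bullet>) P ` cball Q r)"
    by (intro connected_continuous_image continuous_intros)
  moreover have "P \<bullet> Z \<in> (\<bullet>) P ` cball Q r" "P \<bullet> M \<in> (\<bullet>) P ` cball Q r"
    using assms by (auto simp: dist_norm norm_minus_commute)
  ultimately have "0 \<in> (\<bullet>) P ` cball Q r"
    using assms by (auto simp: connected_iff_interval)
  then show thesis using that by (auto simp: dist_norm norm_minus_commute)
qed

text \<open>For nonzero \<open>H\<close>, infeasibility of the ball minimizer forces
  \<open>a \<ge> 0\<close>. The objective is then nonnegative on the half-space and vanishes at a
  point of the ball on the hyperplane.\<close>

lemma ball_halfspace_min_parallel:
  fixes P Q M X :: "'a::real_inner" and a r :: real
  defines "H \<equiv> a *\<^sub>R P"
  assumes r: "0 \<le> r"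
    and M: "norm (M - Q) \<le> r" "0 \<le> P \<bullet> M"
    and infeas: "H = 0 \<or> P \<bullet> (Q - r *\<^sub>R (H /\<^sub>R norm H)) < 0"
    and X: "0 \<le> P \<bullet> X"
    and min: "\<And>Y. norm (Y - Q) \<le> r \<Longrightarrow> 0 \<le> P \<bullet> Y \<Longrightarrow> H \<bullet> X \<le> H \<bullet> Y"
  shows "H \<bullet> X = 0"
proof (cases "H = 0")
  case False
  let ?Z = "Q - r *\<^sub>R (H /\<^sub>R norm H)"
  have Z: "norm (?Z - Q) \<le> r" "P \<bullet> ?Z < 0"
    using norm_ball_minimizer[OF r] infeas False by auto
  \<comment> \<open>The sign of \<open>a\<close> is read off from \<open>?Z\<close> and
    \<open>M\<close>, since \<open>P\<close> takes a strictly smaller value at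
    \<open>?Z\<close>.\<close>
  have "H \<bullet> ?Z \<le> H \<bullet> M"
    unfolding inner_ball_minimizer by (rule inner_ball_ge[OF M(1)])
  then have "0 \<le> a * (P \<bullet> M - P \<bullet> ?Z)"
    by (simp add: H_def algebra_simps)
  then have "0 \<le> a" using Z M by (simp add: zero_le_mult_iff)
  obtain W where W: "norm (W - Q) \<le> r" "P \<bullet> W = 0"
    using ball_meets_hyperplane[OF M Z(1) less_imp_le[OF Z(2)]] .
  have "H \<bullet> X \<le> H \<bullet> W" using W by (intro min) auto
  moreover have "0 \<le> H \<bullet> X" using X \<open>0 \<le> a\<close> by (simp add: H_def)
  ultimately show ?thesis using W by (simp add: H_def)
qed simp

text \<open>Finite dimension enters here, through compactness of the closed ball.\<close>

lemma ball_halfspace_min_exists: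
  fixes P Q H M :: "'a::euclidean_space"
  assumes "norm (M - Q) \<le> r" "0 \<le> P \<bullet> M"
  obtains X where "norm (X - Q) \<le> r" "0 \<le> P \<bullet> X"
    "\<And>Y. norm (Y - Q) \<le> r \<Longrightarrow> 0 \<le> P \<bullet> Y \<Longrightarrow> H \<bullet> X \<le> H \<bullet> Y"
proof -
  let ?S = "cball Q r \<inter> {X. 0 \<le> P \<bullet> X}"
  have "compact ?S"
    by (intro compact_Int_closed compact_cball closed_Collect_le continuous_intros)
  moreover have "M \<in> ?S" using assms by (simp add: dist_norm norm_minus_commute)
  moreover have "continuous_on ?S ((\<bullet>) H)" by (intro continuous_intros)
  ultimately obtain X where "X \<in> ?S" "\<forall>Y\<in>?S. H \<bullet> X \<le> H \<bullet> Y"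
    using continuous_attains_inf[of ?S "(\<bullet>) H"] by blast
  then show thesis using that[of X] by (simp add: dist_norm norm_minus_commute)
qed

lemma screening_feasible_iff:
  assumes "0 \<le> r"
  shows "screening_feasible Q r P X \<longleftrightarrow> norm (X - Q) \<le> r \<and> 0 \<le> P \<bullet> X"
  using assms
  by (simp add: screening_feasible_def frob_inner_eq_inner frob_norm_eq_norm power_mono_iff)

lemma screening_solution_iff:
  assumes "0 \<le> r"
  shows "screening_solution H Q r P X \<longleftrightarrow> norm (X - Q) \<le> r \<and> 0 \<le> P \<bullet> X \<and>
    (\<forall>Y. norm (Y - Q) \<le> r \<and> 0 \<le> P \<bullet> Y \<longrightarrow> H \<bullet> X \<le> H \<bullet> Y)"
  by (auto simp: screening_solution_def is_arg_min_def screening_feasible_iff[OF assms]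
      frob_inner_eq_inner inner_commute[of _ H] not_less)

theorem theorem3p1:
  fixes x :: "nat \<Rightarrow> real^'d" and y :: "nat \<Rightarrow> 'c" and n i j l :: nat
    and loss :: "real \<Rightarrow> real" and lam r \<alpha> \<beta> :: real
    and Mstar Q P H :: "real^'d^'d"
  assumes loss: "loss = hinge \<or> (\<exists>\<gamma>>0. loss = smoothed_hinge \<gamma>)"
    and lam: "lam > 0"
    and Mstar: "is_arg_min (metric_objective loss lam n x y) psd Mstar"
    and r: "r \<ge> 0"
    and sphere: "frob_norm (Mstar - Q) \<le> r"
    and triplet: "(i, j, l) \<in> triplets n y"
    and H: "H = triplet_mat x i j l"
    and halfspace: "{M. psd M} \<subseteq> {X. frob_inner P X \<ge> 0}"
    and \<alpha>: "\<alpha> = sqrt (((frob_norm P)\<^sup>2 * (frob_norm H)\<^sup>2 - (frob_inner P H)\<^sup>2)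
                  / (r\<^sup>2 * (frob_norm P)\<^sup>2 - (frob_inner P Q)\<^sup>2))"
    and \<beta>: "\<beta> = (frob_inner P H - \<alpha> * frob_inner P Q) / (frob_norm P)\<^sup>2"
  shows "(\<exists>X. screening_solution H Q r P X) \<and>
    (\<forall>X. screening_solution H Q r P X \<longrightarrow>
       ((\<exists>a. H = a *\<^sub>R P) \<and> \<not> ball_minimizer_feasible H Q r P \<longrightarrow>
          frob_inner H X = 0) \<and>
       (ball_minimizer_feasible H Q r P \<longrightarrow>
          frob_inner H X = frob_inner H Q - r * frob_norm H) \<and>
       (\<not> (\<exists>a. H = a *\<^sub>R P) \<and> \<not> ball_minimizer_feasible H Q r P \<and>
        r\<^sup>2 * (frob_norm P)\<^sup>2 - (frob_inner P Q)\<^sup>2 \<noteq> 0 \<longrightarrow>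
          frob_inner H X = frob_inner H ((\<beta> *\<^sub>R P - H) /\<^sub>R \<alpha> + Q)))"
proof (intro conjI allI impI)
  \<comment> \<open>As a minimizer over \<open>psd\<close>, \<open>Mstar\<close> is itself positive
    semi-definite and so lies in the half-space.\<close>
  have M: "norm (Mstar - Q) \<le> r" "0 \<le> P \<bullet> Mstar"
    using sphere Mstar halfspace
    by (auto simp: frob_norm_eq_norm frob_inner_eq_inner is_arg_min_def)
  note infeasible_iff = ball_minimizer_feasible_def frob_inner_eq_inner frob_norm_eq_norm
    not_le de_Morgan_conj not_not
  show "\<exists>X. screening_solution H Q r P X"
    unfolding screening_solution_iff[OF r] by (rule ball_halfspace_min_exists[OF M, of H]) blast
  fix X assume "screening_solution H Q r P X"
  then have X: "norm (X - Q) \<le> r" "0 \<le> P \<bullet> X"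
    and min: "\<And>Y. norm (Y - Q) \<le> r \<Longrightarrow> 0 \<le> P \<bullet> Y \<Longrightarrow> H \<bullet> X \<le> H \<bullet> Y"
    unfolding screening_solution_iff[OF r] by auto
  {
    assume "(\<exists>a. H = a *\<^sub>R P) \<and> \<not> ball_minimizer_feasible H Q r P"
    then obtain a where a: "H = a *\<^sub>R P"
      and infeas: "H = 0 \<or> P \<bullet> (Q - r *\<^sub>R (H /\<^sub>R norm H)) < 0"
      unfolding infeasible_iff by blast
    show "frob_inner H X = 0"
      using ball_halfspace_min_parallel[OF r M infeas[unfolded a] X(2) min[unfolded a]]
      by (simp add: a frob_inner_eq_inner)
  next
    let ?Z = "Q - r *\<^sub>R (H /\<^sub>R norm H)"
    assume "ball_minimizer_feasible H Q r P"
    then have "0 \<le> P \<bullet> ?Z" unfolding infeasible_iff by blast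
    then have "H \<bullet> X \<le> H \<bullet> ?Z" by (intro min norm_ball_minimizer r)
    with inner_ball_ge[OF X(1), of H]
    show "frob_inner H X = frob_inner H Q - r * frob_norm H"
      unfolding inner_ball_minimizer frob_inner_eq_inner frob_norm_eq_norm by linarith
  next
    let ?X = "(\<beta> *\<^sub>R P - H) /\<^sub>R \<alpha> + Q"
    assume *: "\<not> (\<exists>a. H = a *\<^sub>R P) \<and> \<not> ball_minimizer_feasible H Q r P \<and>
      r\<^sup>2 * (frob_norm P)\<^sup>2 - (frob_inner P Q)\<^sup>2 \<noteq> 0"
    then have indep: "\<nexists>a. H = a *\<^sub>R P" by blast
    \<comment> \<open>The zero matrix is a multiple of \<open>P\<close>. With \<open>H\<close>
      nonzero, the negation of \<open>ball_minimizer_feasible\<close> is a strict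
      inequality.\<close>
    then have "H \<noteq> 0" by (metis scale_zero_left)
    with * have infeas: "P \<bullet> (Q - r *\<^sub>R (H /\<^sub>R norm H)) < 0"
      and D: "r\<^sup>2 * (norm P)\<^sup>2 - (P \<bullet> Q)\<^sup>2 \<noteq> 0"
      unfolding infeasible_iff by auto
    note opt = ball_halfspace_min_boundary[OF r M indep infeas D
        \<alpha>[unfolded frob_inner_eq_inner frob_norm_eq_norm]
        \<beta>[unfolded frob_inner_eq_inner frob_norm_eq_norm] refl]
    \<comment> \<open>Both points are feasible and optimal, so their values agree; uniqueness of the
      minimizer is not invoked.\<close>
    show "frob_inner H X = frob_inner H ?X"
      unfolding frob_inner_eq_inner
      using min[OF opt(1,2)] opt(3)[OF X] by (rule antisym)
  }
qed

end
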